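(* Let $\mathcal{L}: x+y-z=0$ be Schur's equation. Then $d(\mathcal{L},\varepsilon)=\Theta(\varepsilon)$; that is, there exist absolute constants $c,C>0$ such that $c\varepsilon\le d(\mathcal{L},\varepsilon)\le C\varepsilon$ for all $\varepsilon\in(0,1]$.
   Context: For a prime $p$, a set $A\subseteq\mathbb{F}_p$ is solution-free for a homogeneous linear equation $\sum_{i\in[k]} c_i x_i=0$ if there is no $k$-tuple of pairwise distinct elements of $A$ satisfying it in $\mathbb{F}_p$. The Cayley graph $\mathrm{Cay}_{\mathbb{F}_p}(A)$ is the digraph on $\mathbb{F}_p$ with an arc $\vec{uv}$ iff $v-u\in A$; $\alpha$ of a digraph is the independence number of its underlying undirected graph. $D(\mathcal{L},\varepsilon,p)$ is the maximum size of a solution-free set $A$ of $\mathcal{L}$ in $\mathbb{F}_p$ with $\alpha(\mathrm{Cay}_{\mathbb{F}_p}(A))\le\varepsilon p$, and $d(\mathcal{L},\varepsilon):=\limsup_{p\to\infty,\ p\text{ prime}} D(\mathcal{L},\varepsilon,p)/p$. *)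

theory Defs
  imports
    "HOL-Library.Extended_Real"
    "HOL-Library.Liminf_Limsup"
    "HOL-Number_Theory.Cong"
    "HOL-Computational_Algebra.Primes"
    "Graph_Theory.Digraph_Component"
begin

text \<open>
  The field with \<open>p\<close> elements is represented by the residues \<open>0, \<dots>, p - 1\<close>, with
  arithmetic modulo \<open>p\<close>.
\<close>

definition Fp :: "nat \<Rightarrow> int set" where
  "Fp p = {0..<int p}"

text \<open>
  A homogeneous linear equation \<open>c\<^sub>1 x\<^sub>1 + \<dots> + c\<^sub>k x\<^sub>k = 0\<close> is given by its list of
  coefficients.  Only solutions with pairwise distinct entries count.
\<close>

definition solution_free :: "int list \<Rightarrow> nat \<Rightarrow> int set \<Rightarrow> bool" where
  "solution_free cs p A \<longleftrightarrow>
     \<not> (\<exists>xs. length xs = length cs \<and> distinct xs \<and> set xs \<subseteq> A \<and>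
            [(\<Sum>i<length cs. cs ! i * xs ! i) = 0] (mod int p))"

definition schur_eq :: "int list" where
  "schur_eq = [1, 1, -1]"

definition cayley_digraph :: "nat \<Rightarrow> int set \<Rightarrow> int pair_pre_digraph" where
  "cayley_digraph p A =
     \<lparr>pverts = Fp p, parcs = {(u, v). u \<in> Fp p \<and> v \<in> Fp p \<and> (v - u) mod int p \<in> A}\<rparr>"

text \<open>
  The underlying undirected graph is simple: a loop, which the Cayley digraph has when
  \<open>0 \<in> A\<close>, does not prevent its vertex from belonging to an independent set.
\<close>

definition independent_set :: "('a, 'b) pre_digraph \<Rightarrow> 'a set \<Rightarrow> bool" where
  "independent_set G S \<longleftrightarrow>
     S \<subseteq> verts G \<and> (\<forall>u\<in>S. \<forall>v\<in>S. u \<noteq> v \<longrightarrow> (u, v) \<notin> parcs (mk_symmetric G))"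

definition independence_number :: "('a, 'b) pre_digraph \<Rightarrow> nat" where
  "independence_number G = Max {card S | S. independent_set G S}"

text \<open>
  For small \<open>p\<close> there may be no admissible set at all; the maximum is then \<open>0\<close>.
\<close>

definition max_solution_free :: "int list \<Rightarrow> real \<Rightarrow> nat \<Rightarrow> nat" where
  "max_solution_free cs \<epsilon> p =
     Max (insert 0 {card A | A. A \<subseteq> Fp p \<and> solution_free cs p A \<and>
       real (independence_number (with_proj (cayley_digraph p A))) \<le> \<epsilon> * real p})"

definition solution_free_density :: "int list \<Rightarrow> real \<Rightarrow> ereal" where
  "solution_free_density cs \<epsilon> =
     Limsup (inf sequentially (principal {p. prime p}))
       (\<lambda>p. ereal (real (max_solution_free cs \<epsilon> p) / real p))"

end

theory Submission
  imports Defs "HOL-Real_Asymp.Real_Asymp"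
begin

text \<open>
  Upper bound: a Schur-free set is almost independent in its own Cayley graph, since an arc
  inside \<open>A\<close> is a solution \<open>u + (v - u) = v\<close>; so \<open>|A|\<close> is at most a constant times the
  independence number.

  Lower bound: sparsity and density are supplied by different parts of the set. A set \<open>S\<close> of only
  \<open>O(log p)\<close> elements, Schur-free and avoiding the short interval \<open>[-m, 4m]\<close> with \<open>m \<approx> \<epsilon>p/64\<close>,
  can have no real Fourier coefficient below \<open>-\<epsilon>|S|\<close>; by the spectral argument of Hoffman's bound
  its Cayley graph has independence number at most \<open>\<epsilon>p\<close>. Adding elements only lowers this number,
  so \<open>S\<close> may be enlarged by all of the sum-free interval \<open>(m, 2m]\<close> except the \<open>O(log\<^sup>2 p)\<close> sums and
  differences of \<open>S\<close>.
\<close>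

section \<open>Orthogonality of cosines and a Hoffman-type bound\<close>

text \<open>Real part of a geometric sum of powers of a \<open>p\<close>-th root of unity
  \<open>z\<close>: every term is 1 when \<open>z = 1\<close>, and otherwise z^p = 1 makes the sum
  vanish.\<close>

lemma sum_cos_multiples:
  fixes n :: int
  assumes "p > 0"
  shows "(\<Sum>k<p. cos (2 * pi * real k * of_int n / real p)) = (if int p dvd n then real p else 0)"
proof -
  define z where "z = cis (2 * pi * of_int n / real p)"
  have zk: "z ^ k = cis (2 * pi * real k * of_int n / real p)" for k
    by (simp add: z_def DeMoivre mult_ac)
  have zp: "z ^ p = 1"
  proof -
    have "cis (2 * pi * real p * of_int n / real p) = cis (2 * pi * of_int n)"
      by (rule arg_cong[where f = cis]) (use assms in simp)
    also have "\<dots> = 1" by (rule cis_multiple_2pi) simp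
    finally show ?thesis by (simp add: zk)
  qed
  have Re: "(\<Sum>k<p. cos (2 * pi * real k * of_int n / real p)) = Re (\<Sum>k<p. z ^ k)"
    by (simp add: zk)
  show ?thesis
  proof (cases "int p dvd n")
    case True
    then obtain q where "n = int p * q" by blast
    then have "z = cis (2 * pi * of_int q)"
      unfolding z_def by (intro arg_cong[where f = cis]) (use assms in simp)
    also have "\<dots> = 1" by (rule cis_multiple_2pi) simp
    finally have "z = 1" .
    then show ?thesis using True Re by simp
  next
    case False
    have "z \<noteq> 1"
    proof
      assume "z = 1"
      then have "cos (2 * pi * of_int n / real p) = 1" by (simp add: z_def complex_eq_iff)
      then obtain q :: int where "2 * pi * of_int n / real p = of_int q * 2 * pi"
        by (auto simp: cos_one_2pi_int)
      then have "of_int n = of_int q * real p" using assms by (simp add: field_simps)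
      then have "n = q * int p" by (metis of_int_eq_iff of_int_mult of_int_of_nat_eq)
      then show False using False by simp
    qed
    then have "(\<Sum>k<p. z ^ k) = 0" using zp by (simp add: sum_gp_strict)
    then show ?thesis using False Re by simp
  qed
qed

text \<open>The summand is symmetric in frequency and residue, so this is orthogonality with the two
  exchanged.\<close>

lemma sum_cos_residues:
  assumes "0 < k" "k < p"
  shows "(\<Sum>s\<in>{0..<int p}. cos (2 * pi * real k * of_int s / real p)) = 0"
proof -
  have "(\<Sum>s\<in>{0..<int p}. cos (2 * pi * real k * of_int s / real p))
      = (\<Sum>j<p. cos (2 * pi * real k * real j / real p))"
    by (rule sum.reindex_bij_witness[of _ int nat]) auto
  also have "\<dots> = (\<Sum>j<p. cos (2 * pi * real j * of_int (int k) / real p))"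
    by (simp add: mult_ac)
  also have "\<dots> = 0"
    using assms by (subst sum_cos_multiples) (auto dest: zdvd_imp_le)
  finally show ?thesis .
qed

lemma Fp_eqI:
  assumes "x \<in> Fp p" "y \<in> Fp p" "int p dvd x - y"
  shows "x = y"
  using assms by (metis Fp_def atLeastLessThan_iff mod_eq_dvd_iff mod_pos_pos_trivial)

text \<open>Summing exp(i(g v - g u)) over all pairs gives the squared modulus of a single
  exponential sum. This is real, so after the shift by \<phi> only cos \<phi> survives in the real
  part.\<close>

lemma sum_cos_diff_pairs:
  fixes g :: "'a \<Rightarrow> real"
  shows "(\<Sum>u\<in>I. \<Sum>v\<in>I. cos (g v - g u - \<phi>))
    = ((\<Sum>u\<in>I. cos (g u))\<^sup>2 + (\<Sum>u\<in>I. sin (g u))\<^sup>2) * cos \<phi>"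
proof -
  define C S where "C = (\<Sum>u\<in>I. cos (g u))" and "S = (\<Sum>u\<in>I. sin (g u))"
  have "cos (g v - g u - \<phi>) = cos (g v) * cos (g u + \<phi>) + sin (g v) * sin (g u + \<phi>)" for u v
    by (simp add: cos_diff flip: diff_diff_eq2) (metis cos_diff diff_diff_eq)
  then have "(\<Sum>u\<in>I. \<Sum>v\<in>I. cos (g v - g u - \<phi>))
      = (\<Sum>u\<in>I. C * cos (g u + \<phi>) + S * sin (g u + \<phi>))"
    by (simp add: sum.distrib C_def S_def sum_distrib_right)
  also have "\<dots> = (\<Sum>u\<in>I. cos (g u) * (C * cos \<phi> + S * sin \<phi>) + sin (g u) * (S * cos \<phi> - C * sin \<phi>))"
    by (simp add: cos_add sin_add algebra_simps)
  also have "\<dots> = C * (C * cos \<phi> + S * sin \<phi>) + S * (S * cos \<phi> - C * sin \<phi>)"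
    by (simp only: sum.distrib C_def S_def sum_distrib_right)
  also have "\<dots> = (C\<^sup>2 + S\<^sup>2) * cos \<phi>"
    by (simp add: algebra_simps power2_eq_square)
  finally show ?thesis by (simp add: C_def S_def)
qed

text \<open>The number of pairs of \<open>I\<close> with difference in \<open>S\<close> is zero;
  expand it into frequencies. Frequency 0 contributes |S||I|^2, and the others can offset at most
  \<delta>|S| times the energy \<open>E\<close> of \<open>I\<close>, which Parseval bounds. Only
  real parts of the Fourier coefficients of \<open>S\<close> enter, so \<open>S\<close> may be
  asymmetric.\<close>

lemma difference_avoiding_set_card_le:
  fixes I S :: "int set"
  assumes "p > 0" and I: "I \<subseteq> {0..<int p}" and S: "finite S" "S \<noteq> {}" and "\<delta> \<ge> 0"
    and avoid: "\<And>u v s. u \<in> I \<Longrightarrow> v \<in> I \<Longrightarrow> s \<in> S \<Longrightarrow> \<not> int p dvd v - u - s"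
    and bound: "\<And>k. 0 < k \<Longrightarrow> k < p \<Longrightarrow>
      (\<Sum>s\<in>S. - cos (2 * pi * real k * of_int s / real p)) \<le> \<delta> * real (card S)"
  shows "real (card I) \<le> \<delta> * real p"
proof (cases "I = {}")
  case True
  then show ?thesis using \<open>\<delta> \<ge> 0\<close> by simp
next
  case False
  have finI: "finite I" using I by (rule finite_subset) simp
  define \<theta> where "\<theta> k n = 2 * pi * real k * of_int n / real p" for k :: nat and n :: int
  define E where "E k = (\<Sum>u\<in>I. cos (\<theta> k u))\<^sup>2 + (\<Sum>u\<in>I. sin (\<theta> k u))\<^sup>2" for k
  define c where "c k = (\<Sum>s\<in>S. cos (\<theta> k s))" for k
  have E_nonneg: "E k \<ge> 0" for k by (simp add: E_def)
  have \<theta>_diff: "\<theta> k (a - b) = \<theta> k a - \<theta> k b" for k a b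
    by (simp add: \<theta>_def right_diff_distrib diff_divide_distrib)
  have orth: "(\<Sum>k<p. cos (\<theta> k n)) = (if int p dvd n then real p else 0)" for n
    unfolding \<theta>_def using \<open>p > 0\<close> by (rule sum_cos_multiples)

  \<comment> \<open>By orthogonality this is \<open>p\<close> times the number of triples with v - u
    = s modulo \<open>p\<close>, all excluded by \<open>avoid\<close>.\<close>
  have "(\<Sum>k<p. E k * c k) = (\<Sum>k<p. \<Sum>s\<in>S. \<Sum>u\<in>I. \<Sum>v\<in>I. cos (\<theta> k (v - u - s)))"
    by (simp add: \<theta>_diff sum_cos_diff_pairs E_def c_def sum_distrib_left)
  also have "\<dots> = (\<Sum>s\<in>S. \<Sum>u\<in>I. \<Sum>v\<in>I. \<Sum>k<p. cos (\<theta> k (v - u - s)))"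
    by (subst sum.swap, intro sum.cong refl, subst sum.swap, intro sum.cong refl, rule sum.swap)
  also have "\<dots> = 0"
    by (simp add: orth avoid)
  finally have zero: "(\<Sum>k<p. E k * c k) = 0" .

  have "(\<Sum>k<p. E k) = (\<Sum>k<p. \<Sum>u\<in>I. \<Sum>v\<in>I. cos (\<theta> k (v - u)))"
    using sum_cos_diff_pairs[where I = I and \<phi> = 0] by (simp add: \<theta>_diff E_def)
  also have "\<dots> = (\<Sum>u\<in>I. \<Sum>v\<in>I. \<Sum>k<p. cos (\<theta> k (v - u)))"
    by (subst sum.swap, intro sum.cong refl, rule sum.swap)
  also have "\<dots> = (\<Sum>u\<in>I. \<Sum>v\<in>I. if v = u then real p else 0)"
  proof (intro sum.cong refl)
    fix u v assume "u \<in> I" "v \<in> I"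
    then have "u \<in> Fp p" "v \<in> Fp p" using I by (auto simp: Fp_def)
    then have "int p dvd v - u \<longleftrightarrow> v = u" using Fp_eqI[of v p u] by auto
    then show "(\<Sum>k<p. cos (\<theta> k (v - u))) = (if v = u then real p else 0)"
      by (simp add: orth)
  qed
  also have "\<dots> = real p * real (card I)"
    using finI by simp
  finally have parseval: "(\<Sum>k<p. E k) = real p * real (card I)" .

  have split: "(\<Sum>k<p. h k) = h 0 + (\<Sum>k\<in>{1..<p}. h k)" for h :: "nat \<Rightarrow> real"
    using \<open>p > 0\<close> by (simp add: lessThan_atLeast0 sum.atLeast_Suc_lessThan)
  have "(\<Sum>k\<in>{1..<p}. - (\<delta> * card S) * E k) \<le> (\<Sum>k\<in>{1..<p}. c k * E k)"
  proof (intro sum_mono mult_right_mono E_nonneg)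
    fix k assume "k \<in> {1..<p}"
    then show "- (\<delta> * card S) \<le> c k"
      using bound[of k] by (simp add: c_def \<theta>_def sum_negf)
  qed
  moreover have "E 0 = real (card I) * real (card I)" "c 0 = real (card S)"
    by (simp_all add: E_def c_def \<theta>_def power2_eq_square)
  ultimately have "real (card S) * (real (card I) * real (card I))
      \<le> \<delta> * real (card S) * (\<Sum>k\<in>{1..<p}. E k)"
    using zero split[of "\<lambda>k. E k * c k"] by (simp add: sum_distrib_left sum_negf mult_ac)
  also have "\<dots> \<le> \<delta> * real (card S) * (real p * real (card I))"
    using parseval split[of E] E_nonneg[of 0] \<open>\<delta> \<ge> 0\<close> by (intro mult_left_mono) auto
  finally show ?thesis
    using False finI S by (simp add: card_gt_0_iff mult_ac)
qed

section \<open>Greedy selection by exponential moments\<close>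

lemma exp_le_quadratic:
  fixes x :: real
  assumes "x \<le> 1"
  shows "exp x \<le> 1 + x + x\<^sup>2"
proof (cases "x \<ge> 0")
  case True
  then show ?thesis using assms exp_bound by blast
next
  case False
  \<comment> \<open>The product is 1 - x^3, and x is negative here.\<close>
  have "1 \<le> (1 - x) * (1 + x + x\<^sup>2)"
    using False mult_nonpos_nonneg[of x "x * x"] by (simp add: algebra_simps power2_eq_square)
  also have "\<dots> \<le> exp (- x) * (1 + x + x\<^sup>2)"
  proof (intro mult_right_mono)
    show "1 - x \<le> exp (- x)" using exp_ge_add_one_self[of "- x"] by simp
    have "0 \<le> (x + 1/2)\<^sup>2 + 3/4" by simp
    then show "0 \<le> 1 + x + x\<^sup>2" by (simp add: power2_eq_square algebra_simps)
  qed
  finally show ?thesis by (simp add: exp_minus field_simps)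
qed

text \<open>
  Chernoff's bound without probability: the exponential moments are the potential of a greedy
  choice, and averaging over the admissible extensions shows that one of them does not increase
  the potential by more than the expected factor.
\<close>

lemma greedy_low_discrepancy:
  fixes f :: "'i \<Rightarrow> 'a \<Rightarrow> real"
  assumes "finite X" and f: "\<And>i s. i \<in> X \<Longrightarrow> \<bar>f i s\<bar> \<le> 1" and t: "0 < t" "t \<le> 1"
    and "P {}"
    and ext: "\<And>S. finite S \<Longrightarrow> P S \<Longrightarrow> card S < K \<Longrightarrow>
      \<exists>Q. finite Q \<and> Q \<noteq> {} \<and> (\<forall>s\<in>Q. s \<notin> S \<and> P (insert s S)) \<and>
          (\<forall>i\<in>X. (\<Sum>s\<in>Q. f i s) \<le> \<eta> * real (card Q))"
  obtains S where "finite S" "card S = K" "P S"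
    "\<And>i. i \<in> X \<Longrightarrow> (\<Sum>s\<in>S. f i s) \<le> ln (real (card X)) / t + real K * (\<eta> + t)"
proof -
  \<comment> \<open>\<open>M\<close> bounds the mean growth factor of one term of the potential,
    through 1 + y \<le> exp y with y = t \<eta> + t^2.\<close>
  define M where "M = exp (t * \<eta> + t\<^sup>2)"
  define \<Phi> where "\<Phi> S = (\<Sum>i\<in>X. exp (t * (\<Sum>s\<in>S. f i s)))" for S
  have "\<exists>S. finite S \<and> card S = k \<and> P S \<and> \<Phi> S \<le> real (card X) * M ^ k" if "k \<le> K" for k
    using that
  proof (induction k)
    case 0
    then show ?case using \<open>P {}\<close> by (intro exI[of _ "{}"]) (simp add: \<Phi>_def)
  next
    case (Suc k)
    then obtain S where S: "finite S" "card S = k" "P S" "\<Phi> S \<le> real (card X) * M ^ k" by auto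
    obtain Q where Q: "finite Q" "Q \<noteq> {}" "\<And>s. s \<in> Q \<Longrightarrow> s \<notin> S \<and> P (insert s S)"
        "\<And>i. i \<in> X \<Longrightarrow> (\<Sum>s\<in>Q. f i s) \<le> \<eta> * real (card Q)"
      using ext[of S] S Suc.prems by auto
    have mean: "(\<Sum>s\<in>Q. exp (t * f i s)) \<le> real (card Q) * M" if "i \<in> X" for i
    proof -
      have "(\<Sum>s\<in>Q. exp (t * f i s)) \<le> (\<Sum>s\<in>Q. 1 + t * f i s + t\<^sup>2)"
      proof (rule sum_mono)
        fix s
        have "t * f i s \<le> t * 1"
          using f[OF that, of s] t by (intro mult_left_mono) auto
        then have "exp (t * f i s) \<le> 1 + t * f i s + (t * f i s)\<^sup>2"
          using t by (intro exp_le_quadratic) linarith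
        moreover have "t\<^sup>2 * (f i s)\<^sup>2 \<le> t\<^sup>2 * 1"
          using f[OF that, of s] by (intro mult_left_mono) (auto simp: abs_square_le_1)
        ultimately show "exp (t * f i s) \<le> 1 + t * f i s + t\<^sup>2"
          by (simp add: power_mult_distrib)
      qed
      also have "\<dots> = real (card Q) + t * (\<Sum>s\<in>Q. f i s) + real (card Q) * t\<^sup>2"
        by (simp add: sum.distrib sum_distrib_left)
      also have "\<dots> \<le> real (card Q) + t * (\<eta> * real (card Q)) + real (card Q) * t\<^sup>2"
        using Q(4)[OF that] t by simp
      also have "\<dots> = real (card Q) * (1 + (t * \<eta> + t\<^sup>2))"
        by (simp add: algebra_simps)
      also have "\<dots> \<le> real (card Q) * M"
        unfolding M_def by (intro mult_left_mono exp_ge_add_one_self) simp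
      finally show ?thesis .
    qed
    \<comment> \<open>Each \<open>s\<close> in \<open>Q\<close> lies outside \<open>S\<close>, so
      its contribution splits off as a factor; after exchanging the sums, \<open>mean\<close>
      applies to each index separately.\<close>
    have "(\<Sum>s\<in>Q. \<Phi> (insert s S))
        = (\<Sum>s\<in>Q. \<Sum>i\<in>X. exp (t * (\<Sum>s\<in>S. f i s)) * exp (t * f i s))"
      using S Q(3) by (simp add: \<Phi>_def distrib_left exp_add mult_ac)
    also have "\<dots> = (\<Sum>i\<in>X. exp (t * (\<Sum>s\<in>S. f i s)) * (\<Sum>s\<in>Q. exp (t * f i s)))"
      by (subst sum.swap) (simp add: sum_distrib_left)
    also have "\<dots> \<le> (\<Sum>i\<in>X. exp (t * (\<Sum>s\<in>S. f i s)) * (real (card Q) * M))"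
      by (intro sum_mono mult_left_mono mean) auto
    also have "\<dots> = \<Phi> S * (real (card Q) * M)"
      by (simp add: \<Phi>_def sum_distrib_right)
    also have "\<dots> \<le> (real (card X) * M ^ k) * (real (card Q) * M)"
      using S by (intro mult_right_mono) (auto simp: M_def)
    also have "\<dots> = (\<Sum>s\<in>Q. real (card X) * M ^ Suc k)"
      by simp
    finally have sum_le: "(\<Sum>s\<in>Q. \<Phi> (insert s S)) \<le> (\<Sum>s\<in>Q. real (card X) * M ^ Suc k)" .
    have "\<exists>s\<in>Q. \<Phi> (insert s S) \<le> real (card X) * M ^ Suc k"
    proof (rule ccontr)
      assume "\<not> ?thesis"
      then have "(\<Sum>s\<in>Q. real (card X) * M ^ Suc k) < (\<Sum>s\<in>Q. \<Phi> (insert s S))"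
        using Q(1,2) by (intro sum_strict_mono) (auto simp: not_le)
      then show False using sum_le by simp
    qed
    then obtain s where s: "s \<in> Q" "\<Phi> (insert s S) \<le> real (card X) * M ^ Suc k" by blast
    then show ?case using S Q(3)[OF s(1)] by (intro exI[of _ "insert s S"]) auto
  qed
  then obtain S where S: "finite S" "card S = K" "P S" "\<Phi> S \<le> real (card X) * M ^ K" by blast
  have "(\<Sum>s\<in>S. f i s) \<le> ln (real (card X)) / t + real K * (\<eta> + t)" if "i \<in> X" for i
  proof -
    have X: "card X > 0" using that \<open>finite X\<close> by (auto simp: card_gt_0_iff)
    \<comment> \<open>A single exponential is at most the whole potential; the claim follows by
      taking logarithms.\<close>
    have "exp (t * (\<Sum>s\<in>S. f i s)) \<le> \<Phi> S"
      unfolding \<Phi>_def using that \<open>finite X\<close> by (intro member_le_sum) auto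
    also have "\<dots> \<le> real (card X) * M ^ K" by (rule S)
    also have "\<dots> = exp (ln (real (card X)) + real K * (t * \<eta> + t\<^sup>2))"
      using X by (simp add: exp_add M_def exp_of_nat_mult)
    finally have "t * (\<Sum>s\<in>S. f i s) \<le> ln (real (card X)) + real K * (t * \<eta> + t\<^sup>2)"
      by simp
    then show ?thesis using t by (simp add: field_simps power2_eq_square)
  qed
  then show ?thesis using S that by blast
qed


section \<open>Independent sets of Cayley digraphs and extremal solution-free sets\<close>

text \<open>Each pair is tested in both orders, so the reversed arcs added by
  \<open>mk_symmetric\<close> impose no further condition.\<close>

lemma independent_set_cayley_iff:
  "independent_set (with_proj (cayley_digraph p A)) I \<longleftrightarrow>
    I \<subseteq> Fp p \<and> (\<forall>u\<in>I. \<forall>v\<in>I. u \<noteq> v \<longrightarrow> (v - u) mod int p \<notin> A)"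
proof -
  have arcs: "(u, v) \<in> parcs (mk_symmetric (with_proj (cayley_digraph p A))) \<longleftrightarrow>
      u \<in> Fp p \<and> v \<in> Fp p \<and> ((v - u) mod int p \<in> A \<or> (u - v) mod int p \<in> A)" for u v
    unfolding parcs_mk_symmetric by (force simp: cayley_digraph_def)
  have verts: "verts (with_proj (cayley_digraph p A)) = Fp p"
    by (simp add: cayley_digraph_def)
  show ?thesis
    unfolding independent_set_def arcs verts by (metis subset_iff)
qed

lemma finite_independent_cards:
  "finite {card S | S. independent_set (with_proj (cayley_digraph p A)) S}"
proof (rule finite_subset)
  show "{card S | S. independent_set (with_proj (cayley_digraph p A)) S} \<subseteq> card ` Pow (Fp p)"
    by (auto simp: independent_set_cayley_iff)
qed (simp add: Fp_def)

lemma card_le_independence_number_cayley: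
  assumes "independent_set (with_proj (cayley_digraph p A)) I"
  shows "card I \<le> independence_number (with_proj (cayley_digraph p A))"
  unfolding independence_number_def using assms finite_independent_cards by (intro Max_ge) auto

lemma independence_number_cayley_attained:
  obtains I where "independent_set (with_proj (cayley_digraph p A)) I"
    "card I = independence_number (with_proj (cayley_digraph p A))"
proof -
  let ?C = "{card S | S. independent_set (with_proj (cayley_digraph p A)) S}"
  have "independent_set (with_proj (cayley_digraph p A)) {}"
    by (simp add: independent_set_cayley_iff)
  then have "?C \<noteq> {}" by blast
  then have "Max ?C \<in> ?C" by (intro Max_in finite_independent_cards)
  then show ?thesis using that by (auto simp: independence_number_def)
qed

lemma finite_solution_free_cards: "finite {card A | A. A \<subseteq> Fp p \<and> P A}"
proof (rule finite_subset)
  show "{card A | A. A \<subseteq> Fp p \<and> P A} \<subseteq> card ` Pow (Fp p)" by auto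
qed (simp add: Fp_def)

lemma max_solution_free_ge:
  assumes "A \<subseteq> Fp p" "solution_free cs p A"
    "real (independence_number (with_proj (cayley_digraph p A))) \<le> \<epsilon> * real p"
  shows "card A \<le> max_solution_free cs \<epsilon> p"
  unfolding max_solution_free_def
  using assms by (intro Max_ge finite.insertI finite_solution_free_cards) auto

text \<open>The first alternative accounts for the inserted default 0, which need not come from an
  admissible set.\<close>

lemma max_solution_free_attained:
  obtains "max_solution_free cs \<epsilon> p = 0"
  | A where "A \<subseteq> Fp p" "solution_free cs p A"
    "real (independence_number (with_proj (cayley_digraph p A))) \<le> \<epsilon> * real p"
    "card A = max_solution_free cs \<epsilon> p"
proof -
  let ?C = "{card A | A. A \<subseteq> Fp p \<and> solution_free cs p A \<and>
       real (independence_number (with_proj (cayley_digraph p A))) \<le> \<epsilon> * real p}"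
  have "Max (insert 0 ?C) \<in> insert 0 ?C"
    by (intro Max_in finite.insertI finite_solution_free_cards) auto
  then show ?thesis using that unfolding max_solution_free_def by auto
qed

lemma solution_free_schur_iff:
  "solution_free schur_eq p A \<longleftrightarrow>
    (\<forall>x\<in>A. \<forall>y\<in>A. \<forall>z\<in>A. x \<noteq> y \<and> x \<noteq> z \<and> y \<noteq> z \<longrightarrow> \<not> int p dvd x + y - z)"
proof -
  have len: "length xs = length schur_eq \<longleftrightarrow> (\<exists>x y z. xs = [x, y, z])" for xs :: "int list"
    by (auto simp: schur_eq_def length_Suc_conv)
  have sum: "(\<Sum>i<length schur_eq. schur_eq ! i * [x, y, z] ! i) = x + y - z" for x y z
    by (simp add: schur_eq_def)
  show ?thesis
  proof
    assume free: "solution_free schur_eq p A"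
    have "\<not> int p dvd x + y - z" if "x \<in> A" "y \<in> A" "z \<in> A" "x \<noteq> y" "x \<noteq> z" "y \<noteq> z" for x y z
      using free[unfolded solution_free_def not_ex, rule_format, of "[x, y, z]"] that
      by (simp add: sum cong_0_iff, simp add: schur_eq_def)
    then show "\<forall>x\<in>A. \<forall>y\<in>A. \<forall>z\<in>A. x \<noteq> y \<and> x \<noteq> z \<and> y \<noteq> z \<longrightarrow> \<not> int p dvd x + y - z"
      by blast
  qed (auto simp: solution_free_def len sum cong_0_iff)
qed

section \<open>Doubling and the upper bound\<close>

text \<open>2 is invertible modulo an odd \<open>p\<close>. This limits how many elements can have
  their double in a given set.\<close>

lemma double_mod_inj_on_Fp:
  assumes "odd p"
  shows "inj_on (\<lambda>x. 2 * x mod int p) (Fp p)"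
proof (rule inj_onI)
  fix x y assume xy: "x \<in> Fp p" "y \<in> Fp p" "2 * x mod int p = 2 * y mod int p"
  then have "int p dvd 2 * (x - y)" by (simp add: mod_eq_dvd_iff right_diff_distrib)
  moreover have "coprime (int p) 2" using assms by simp
  ultimately have "int p dvd x - y" using coprime_dvd_mult_right_iff by blast
  then show "x = y" using xy by (intro Fp_eqI)
qed

text \<open>
  Inside \<open>A\<close> the only arcs of the Cayley graph join some \<open>x\<close> to \<open>2x\<close>, so a maximal independent
  subset \<open>I\<close> of \<open>A\<close> covers \<open>A\<close> together with its double and its half.
\<close>

lemma card_schur_free_le:
  assumes "odd p" and A: "A \<subseteq> Fp p" "solution_free schur_eq p A"
  shows "card A \<le> 3 * independence_number (with_proj (cayley_digraph p A)) + 1"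
proof -
  let ?ind = "independent_set (with_proj (cayley_digraph p A))"
  \<comment> \<open>Zero has an arc to every element of \<open>A\<close>, by the degenerate solution
    0 + v = v. Setting it aside costs the final 1.\<close>
  define B where "B = A - {0}"
  have finA: "finite A" using A(1) by (rule finite_subset) (simp add: Fp_def)
  have B: "B \<subseteq> A" "finite B" "0 \<notin> B" using finA by (auto simp: B_def)
  have range: "0 < x \<and> x < int p" if "x \<in> B" for x
    using that A(1) by (force simp: B_def Fp_def)
  let ?F = "{I. I \<subseteq> B \<and> ?ind I}"
  have "finite ?F" using B by (intro finite_subset[of ?F "Pow B"]) auto
  moreover have "{} \<in> ?F" by (simp add: independent_set_cayley_iff)
  ultimately have "\<exists>I\<in>?F. \<forall>J\<in>?F. I \<subseteq> J \<longrightarrow> I = J"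
    by (intro finite_has_maximal) auto
  then obtain I where I: "I \<in> ?F" and max: "\<forall>J\<in>?F. I \<subseteq> J \<longrightarrow> I = J"
    by (rule bexE)
  have finI: "finite I" using I B by (auto intro: finite_subset)
  let ?d = "\<lambda>x. 2 * x mod int p"
  \<comment> \<open>With w = v - u in \<open>A\<close>, the solution u + w = v must repeat an entry.
    Since w = v would force u = 0, only w = u remains.\<close>
  have arc: "v = ?d u" if "u \<in> B" "v \<in> B" "u \<noteq> v" "(v - u) mod int p \<in> A" for u v
  proof -
    let ?w = "(v - u) mod int p"
    have "int p dvd u + ?w - v"
    proof -
      have "int p dvd - ((v - u) - ?w)" by (simp only: dvd_minus_iff dvd_minus_mod)
      then show ?thesis by (simp only: minus_diff_eq diff_diff_eq2 add.commute)
    qed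
    then have "?w = u \<or> ?w = v"
      using A(2)[unfolded solution_free_schur_iff, rule_format, of u ?w v]
        that B(1)[THEN subsetD, of u] B(1)[THEN subsetD, of v] by metis
    moreover have "?w \<noteq> v"
    proof
      assume "?w = v"
      then have "(v - u) mod int p = v mod int p" using range[OF that(2)] by simp
      then have "int p dvd u" by (simp add: mod_eq_dvd_iff)
      then show False using range[OF that(1)] by (auto dest: zdvd_imp_le)
    qed
    ultimately have "(v - u) mod int p = u mod int p" using range[OF that(1)] by simp
    then have "v mod int p = ?d u" by (simp add: mod_eq_dvd_iff algebra_simps)
    then show ?thesis using range[OF that(2)] by simp
  qed
  \<comment> \<open>By maximality an element outside \<open>I\<close> is joined to some member of
    \<open>I\<close>, and by \<open>arc\<close> one of the two is the double of the other.\<close>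
  have "B \<subseteq> I \<union> ?d ` I \<union> {x \<in> B. ?d x \<in> I}"
  proof
    fix a assume a: "a \<in> B"
    show "a \<in> I \<union> ?d ` I \<union> {x \<in> B. ?d x \<in> I}"
    proof (cases "a \<in> I")
      case False
      then have "\<not> ?ind (insert a I)" using bspec[OF max, of "insert a I"] I a by auto
      then obtain u where "u \<in> I" "u \<noteq> a" "(a - u) mod int p \<in> A \<or> (u - a) mod int p \<in> A"
        using I a range[OF a] by (auto simp: independent_set_cayley_iff Fp_def)
      then show ?thesis using arc[of u a] arc[of a u] I a by auto
    qed simp
  qed
  then have "card B \<le> card (I \<union> ?d ` I \<union> {x \<in> B. ?d x \<in> I})"
    using finI B by (intro card_mono) auto
  also have "\<dots> \<le> card I + card (?d ` I) + card {x \<in> B. ?d x \<in> I}"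
    by (meson add_le_mono1 card_Un_le order_trans)
  also have "card (?d ` I) \<le> card I" using finI by (rule card_image_le)
  also have "card {x \<in> B. ?d x \<in> I} \<le> card I"
  proof (rule card_inj_on_le)
    show "inj_on ?d {x \<in> B. ?d x \<in> I}"
      using A B by (intro inj_on_subset[OF double_mod_inj_on_Fp[OF \<open>odd p\<close>]]) auto
  qed (use finI in auto)
  finally have "card B \<le> 3 * card I" by simp
  moreover have "card I \<le> independence_number (with_proj (cayley_digraph p A))"
    using I by (intro card_le_independence_number_cayley) simp
  moreover have "card A \<le> card B + 1"
    using diff_card_le_card_Diff[of "{0}" A] by (simp add: B_def)
  ultimately show ?thesis by simp
qed

section \<open>Extending Schur-free sets\<close>

text \<open>The residues that can complete two elements of \<open>S\<close> to a solution: sums in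
  the place of z, differences in the place of x or y.\<close>

definition sums_and_differences :: "nat \<Rightarrow> int set \<Rightarrow> int set" where
  "sums_and_differences p S = (\<lambda>(x, y). (x + y) mod int p) ` (S \<times> S)
     \<union> (\<lambda>(x, y). (x - y) mod int p) ` (S \<times> S)"

lemma finite_sums_and_differences: "finite S \<Longrightarrow> finite (sums_and_differences p S)"
  by (simp add: sums_and_differences_def)

lemma card_sums_and_differences_le:
  assumes "finite S"
  shows "card (sums_and_differences p S) \<le> 2 * (card S)\<^sup>2"
proof -
  have "card (h ` (S \<times> S)) \<le> (card S)\<^sup>2" for h :: "int \<times> int \<Rightarrow> int"
    using card_image_le[of "S \<times> S" h] assms by (simp add: card_cartesian_product power2_eq_square)
  from this[of "\<lambda>(x, y). (x + y) mod int p"] this[of "\<lambda>(x, y). (x - y) mod int p"]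
  show ?thesis
    unfolding sums_and_differences_def by (intro order_trans[OF card_Un_le]) simp
qed

lemma sums_and_differencesI:
  assumes "z \<in> Fp p" "x \<in> S" "y \<in> S" "int p dvd x + y - z \<or> int p dvd x - y - z"
  shows "z \<in> sums_and_differences p S"
proof -
  have "z = z mod int p" using assms by (simp add: Fp_def)
  also have "\<dots> = (x + y) mod int p \<or> \<dots> = (x - y) mod int p"
    using assms(4) by (metis mod_eq_dvd_iff)
  finally show ?thesis
    using assms(2,3) unfolding sums_and_differences_def by force
qed

text \<open>Entries are distinct, so a new solution uses \<open>s\<close> exactly once, and the
  other two entries exhibit \<open>s\<close> as a forbidden sum or difference.\<close>

lemma solution_free_schur_insert:
  assumes "solution_free schur_eq p S" "s \<in> Fp p" "s \<notin> sums_and_differences p S"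
  shows "solution_free schur_eq p (insert s S)"
  unfolding solution_free_schur_iff
proof (intro ballI impI notI)
  fix x y z
  assume xyz: "x \<in> insert s S" "y \<in> insert s S" "z \<in> insert s S" "x \<noteq> y \<and> x \<noteq> z \<and> y \<noteq> z"
    and dvd: "int p dvd x + y - z"
  have neg: "int p dvd z - y - x" "int p dvd z - x - y"
    using dvd dvd_diff_commute[of "int p" "x + y" z] by (simp_all add: algebra_simps)
  consider "x \<in> S" "y \<in> S" "z \<in> S" | "z = s" "x \<in> S" "y \<in> S"
    | "x = s" "y \<in> S" "z \<in> S" | "y = s" "x \<in> S" "z \<in> S"
    using xyz by auto
  then show False
  proof cases
    case 1
    then show False using assms(1) xyz dvd unfolding solution_free_schur_iff by blast
  qed (use assms(2,3) sums_and_differencesI dvd neg in blast)+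
qed

text \<open>A solution with exactly one entry in \<open>J\<close> makes it a sum or difference of
  \<open>S\<close>. Sums of two elements of \<open>J\<close> lie in (2m, 4m] and differences in (-m,
  m), which \<open>S\<close> avoids modulo \<open>p\<close>; the sums also miss \<open>J\<close>
  itself.\<close>

lemma solution_free_schur_Un_interval:
  fixes m p :: nat
  assumes S: "solution_free schur_eq p S" "S \<subseteq> {4 * int m<..<int p - int m}"
    and J: "J \<subseteq> {int m<..2 * int m}" "J \<inter> sums_and_differences p S = {}"
    and m: "5 * m < p"
  shows "solution_free schur_eq p (S \<union> J)"
  unfolding solution_free_schur_iff
proof (intro ballI impI notI)
  fix x y z
  assume xyz: "x \<in> S \<union> J" "y \<in> S \<union> J" "z \<in> S \<union> J" "x \<noteq> y \<and> x \<noteq> z \<and> y \<noteq> z"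
    and dvd: "int p dvd x + y - z"
  have neg: "int p dvd z - y - x" "int p dvd z - x - y"
    using dvd dvd_diff_commute[of "int p" "x + y" z] by (simp_all add: algebra_simps)
  have Srange: "4 * int m < s \<and> s < int p - int m" if "s \<in> S" for s
    using that S(2) by auto
  have Jrange: "int m < j \<and> j \<le> 2 * int m \<and> j \<in> Fp p \<and> j \<notin> sums_and_differences p S"
    if "j \<in> J" for j
    using that J m by (force simp: Fp_def)
  \<comment> \<open>In the last four cases the ranges place the relevant combination strictly
    between 0 and \<open>p\<close>, where no multiple of \<open>p\<close> lies.\<close>
  have small: False if "0 < x + y - z" "x + y - z < int p"
    using dvd that by (auto dest: zdvd_imp_le)
  have small': False if "0 < z - x - y" "z - x - y < int p"
    using neg(2) that by (auto dest: zdvd_imp_le)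
  consider "x \<in> S" "y \<in> S" "z \<in> S" | "x \<in> S" "y \<in> S" "z \<in> J" | "x \<in> S" "y \<in> J" "z \<in> S"
    | "x \<in> J" "y \<in> S" "z \<in> S" | "x \<in> S" "y \<in> J" "z \<in> J" | "x \<in> J" "y \<in> S" "z \<in> J"
    | "x \<in> J" "y \<in> J" "z \<in> S" | "x \<in> J" "y \<in> J" "z \<in> J"
    using xyz by blast
  then show False
  proof cases
    case 1
    then show False using S(1) xyz dvd unfolding solution_free_schur_iff by blast
  next
    case 2
    then show False using Jrange sums_and_differencesI dvd by blast
  next
    case 3
    then show False using Jrange sums_and_differencesI neg by blast
  next
    case 4
    then show False using Jrange sums_and_differencesI neg by blast
  next
    case 5
    then show False using Srange[of x] Jrange[of y] Jrange[of z] small by linarith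
  next
    case 6
    then show False using Srange[of y] Jrange[of x] Jrange[of z] small by linarith
  next
    case 7
    then show False using Srange[of z] Jrange[of x] Jrange[of y] small' by linarith
  next
    case 8
    then show False using Jrange[of x] Jrange[of y] Jrange[of z] m small by linarith
  qed
qed

section \<open>The construction for the lower bound\<close>

text \<open>\<open>K\<close> is the size of the sparse part. It must be large against log p to
  control all cosine sums, while its square must be small against \<epsilon>p so that the forbidden
  sums and differences cost little.\<close>

lemma ex_dense_schur_free:
  fixes \<epsilon> :: real and p K :: nat
  assumes \<epsilon>: "0 < \<epsilon>" "\<epsilon> \<le> 1" and "K > 0" and K: "16 * ln (real p) / \<epsilon>\<^sup>2 \<le> real K"
    and p: "3 * (real K)\<^sup>2 + 1 \<le> \<epsilon> * real p / 128"
  obtains A where "A \<subseteq> Fp p" "solution_free schur_eq p A"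
    "real (independence_number (with_proj (cayley_digraph p A))) \<le> \<epsilon> * real p"
    "\<epsilon> * real p / 128 \<le> real (card A)"
proof -
  define m where "m = nat \<lfloor>\<epsilon> * real p / 64\<rfloor>"
  have "0 < \<epsilon> * real p / 128" using p zero_le_power2[of "real K"] by linarith
  then have "p > 0" using \<epsilon> by (simp add: zero_less_mult_iff)
  have m: "real m \<le> \<epsilon> * real p / 64" "\<epsilon> * real p / 64 < real m + 1"
    unfolding m_def using \<open>0 < \<epsilon> * real p / 128\<close> by linarith+
  have \<epsilon>p: "\<epsilon> * real p \<le> real p" using \<epsilon> by (simp add: mult_left_le_one_le)
  then have "5 * real m < real p" using m \<open>p > 0\<close> by linarith
  then have m_p: "5 * m < p" by linarith

  define T where "T = {4 * int m<..<int p - int m}"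
  define P where "P S \<longleftrightarrow> S \<subseteq> T \<and> solution_free schur_eq p S" for S
  define f where "f k s = - cos (2 * pi * real k * of_int s / real p)" for k :: nat and s :: int
  have T: "T \<subseteq> Fp p" by (auto simp: T_def Fp_def)
  have ext: "\<exists>Q. finite Q \<and> Q \<noteq> {} \<and> (\<forall>s\<in>Q. s \<notin> S \<and> P (insert s S)) \<and>
      (\<forall>k\<in>{1..<p}. (\<Sum>s\<in>Q. f k s) \<le> \<epsilon> / 4 * real (card Q))"
    if S: "finite S" "P S" "card S < K" for S
  proof -
    define B where "B = S \<union> sums_and_differences p S"
    define Q where "Q = T - B"
    have "finite Q" by (simp add: Q_def T_def)
    have "finite B" using S by (simp add: B_def finite_sums_and_differences)
    have "card B \<le> card S + 2 * (card S)\<^sup>2"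
      unfolding B_def using card_Un_le card_sums_and_differences_le[OF S(1)]
      by (meson add_left_mono order_trans)
    also have "\<dots> \<le> 3 * (card S)\<^sup>2" by (simp add: power2_eq_square)
    also have "\<dots> \<le> 3 * K\<^sup>2" using S by (simp add: power_mono)
    finally have cardB: "card B \<le> 3 * K\<^sup>2" .
    \<comment> \<open>The cosine sum over all residues vanishes, so the sum over \<open>Q\<close> is
      minus the sum over its complement \<open>R\<close> and is at most |R|.\<close>
    define R where "R = Fp p - Q"
    have "R \<subseteq> {0..4 * int m} \<union> {int p - int m..<int p} \<union> B"
      by (auto simp: R_def Q_def T_def Fp_def)
    then have "card R \<le> card ({0..4 * int m} \<union> {int p - int m..<int p} \<union> B)"
      using \<open>finite B\<close> by (intro card_mono) auto
    also have "\<dots> \<le> card {0..4 * int m} + card {int p - int m..<int p} + card B"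
      by (meson add_le_mono1 card_Un_le order_trans)
    also have "\<dots> \<le> 5 * m + 1 + 3 * K\<^sup>2" using cardB by simp
    finally have "real (card R) \<le> real (5 * m + 1 + 3 * K\<^sup>2)" by (simp only: of_nat_le_iff)
    \<comment> \<open>5m is at most 10\<epsilon>p/128 and the rest at most \<epsilon>p/128, together
      below \<epsilon>p/8.\<close>
    then have cardR: "real (card R) \<le> \<epsilon> / 8 * real p" using m p by simp
    have QFp: "Q \<subseteq> Fp p" using T by (auto simp: Q_def)
    have finFp: "finite (Fp p)" "card (Fp p) = p" by (simp_all add: Fp_def)
    have "card R = p - card Q" using QFp finFp by (simp add: R_def card_Diff_subset \<open>finite Q\<close>)
    moreover have "card Q \<le> p" using card_mono[OF finFp(1) QFp] finFp by simp
    ultimately have cardQ: "real p / 2 \<le> real (card Q)"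
      using cardR \<epsilon>p by simp
    have "(\<Sum>s\<in>Q. f k s) \<le> \<epsilon> / 4 * real (card Q)" if k: "k \<in> {1..<p}" for k
    proof -
      have "(\<Sum>s\<in>Fp p. f k s) = 0"
        using sum_cos_residues[of k p] k by (simp add: f_def Fp_def sum_negf)
      moreover have "(\<Sum>s\<in>Fp p. f k s) = (\<Sum>s\<in>R. f k s) + (\<Sum>s\<in>Q. f k s)"
        unfolding R_def using QFp finFp by (intro sum.subset_diff)
      moreover have "(\<Sum>s\<in>R. - f k s) \<le> (\<Sum>s\<in>R. 1)"
        by (intro sum_mono) (simp add: f_def)
      ultimately have "(\<Sum>s\<in>Q. f k s) \<le> real (card R)" by (simp add: sum_negf)
      also have "\<dots> \<le> \<epsilon> / 4 * (real p / 2)" using cardR by simp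
      also have "\<dots> \<le> \<epsilon> / 4 * real (card Q)" using cardQ \<epsilon> by (intro mult_left_mono) auto
      finally show ?thesis .
    qed
    moreover have "Q \<noteq> {}" using cardQ \<open>p > 0\<close> by auto
    moreover have "s \<notin> S \<and> P (insert s S)" if "s \<in> Q" for s
      using that S(2) T by (auto simp: P_def Q_def B_def intro!: solution_free_schur_insert)
    ultimately show ?thesis using \<open>finite Q\<close> by blast
  qed
  have "P {}" by (simp add: P_def solution_free_schur_iff)
  define L where "L = ln (real (card {1..<p}))"
  obtain S where S: "finite S" "card S = K" "P S"
      "\<And>k. k \<in> {1..<p} \<Longrightarrow>
        (\<Sum>s\<in>S. f k s) \<le> L / (\<epsilon> / 4) + real K * (\<epsilon> / 4 + \<epsilon> / 4)"
    using greedy_low_discrepancy[of "{1..<p}" f "\<epsilon> / 4" P K "\<epsilon> / 4"] \<open>P {}\<close> ext \<epsilon>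
    by (auto simp: f_def L_def)
  \<comment> \<open>With t and \<eta> both \<epsilon>/4, the drift costs \<epsilon>K/2; the lower
    bound on \<open>K\<close> keeps the logarithmic term below \<epsilon>K/4.\<close>
  have low: "(\<Sum>s\<in>S. f k s) \<le> \<epsilon> * real (card S)" if "0 < k" "k < p" for k
  proof -
    have k: "k \<in> {1..<p}" using that by simp
    have "L \<le> ln (real p)" using that by (simp add: L_def)
    also have "\<dots> \<le> real K * \<epsilon>\<^sup>2 / 16" using K \<epsilon> by (simp add: field_simps)
    finally have "L / (\<epsilon> / 4) \<le> real K * \<epsilon> / 4"
      using \<epsilon> by (simp add: field_simps power2_eq_square)
    then have "(\<Sum>s\<in>S. f k s) \<le> real K * \<epsilon> / 4 + real K * (\<epsilon> / 4 + \<epsilon> / 4)"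
      using S(4)[OF k] by linarith
    also have "\<dots> = 3 / 4 * (\<epsilon> * real K)" by (simp add: algebra_simps)
    also have "\<dots> \<le> \<epsilon> * real (card S)" using \<epsilon> S(2) by simp
    finally show ?thesis .
  qed

  define J where "J = {int m<..2 * int m} - sums_and_differences p S"
  define A where "A = S \<union> J"
  have finJ: "finite J" by (simp add: J_def)
  have "A \<subseteq> Fp p" using S(3) T m_p by (auto simp: A_def P_def J_def Fp_def)
  moreover have "solution_free schur_eq p A"
    unfolding A_def using S(3) m_p
    by (intro solution_free_schur_Un_interval[of _ _ m]) (auto simp: P_def T_def J_def)
  moreover have "real (independence_number (with_proj (cayley_digraph p A))) \<le> \<epsilon> * real p"
  proof -
    obtain I where I: "independent_set (with_proj (cayley_digraph p A)) I"
        "card I = independence_number (with_proj (cayley_digraph p A))"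
      by (rule independence_number_cayley_attained)
    \<comment> \<open>\<open>S\<close> is contained in \<open>A\<close>, so the differences of
      \<open>I\<close> avoid \<open>S\<close>, and the arcs from \<open>S\<close> alone force the
      bound.\<close>
    have "real (card I) \<le> \<epsilon> * real p"
    proof (rule difference_avoiding_set_card_le[of _ _ S])
      show "I \<subseteq> {0..<int p}" using I(1) by (simp add: independent_set_cayley_iff Fp_def)
      show "S \<noteq> {}" using S \<open>K > 0\<close> by auto
      show "\<not> int p dvd v - u - s" if uvs: "u \<in> I" "v \<in> I" "s \<in> S" for u v s
      proof
        assume dvd: "int p dvd v - u - s"
        have s: "0 < s" "s < int p" using uvs S(3) by (auto simp: P_def T_def)
        have "(v - u) mod int p = s mod int p" using dvd by (simp add: mod_eq_dvd_iff)
        then have "(v - u) mod int p = s" using s by simp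
        \<comment> \<open>Independence ignores loops, so equal endpoints are excluded through 0 < s
          < p.\<close>
        moreover have "u \<noteq> v" using dvd s zdvd_not_zless[of s "int p"] by auto
        ultimately show False
          using I(1) uvs by (auto simp: independent_set_cayley_iff A_def)
      qed
      show "(\<Sum>s\<in>S. - cos (2 * pi * real k * of_int s / real p)) \<le> \<epsilon> * real (card S)"
        if "0 < k" "k < p" for k using low[OF that] by (simp add: f_def)
    qed (use S \<epsilon> \<open>p > 0\<close> in auto)
    then show ?thesis using I(2) by simp
  qed
  moreover have "\<epsilon> * real p / 128 \<le> real (card A)"
  proof -
    \<comment> \<open>The interval has \<open>m\<close> elements and loses at most 2K^2; rounding in
      \<open>m\<close> costs less than 1, and both losses fit into \<epsilon>p/128.\<close>
    have "m - 2 * K\<^sup>2 \<le> m - card (sums_and_differences p S)"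
      using card_sums_and_differences_le[OF S(1)] S(2) by (intro diff_le_mono2) simp
    also have "\<dots> \<le> card J"
      using diff_card_le_card_Diff[of "sums_and_differences p S" "{int m<..2 * int m}"] S(1)
      by (simp add: J_def finite_sums_and_differences)
    also have "\<dots> \<le> card A" using S(1) finJ by (intro card_mono) (auto simp: A_def)
    finally have "m \<le> card A + 2 * K\<^sup>2" by simp
    then have "real m \<le> real (card A + 2 * K\<^sup>2)" by (simp only: of_nat_le_iff)
    then have "real m \<le> real (card A) + 2 * (real K)\<^sup>2" by simp
    then show ?thesis using m p zero_le_power2[of "real K"] by linarith
  qed
  ultimately show ?thesis by (rule that)
qed

section \<open>Asymptotics in \<open>p\<close> and the limit superior over primes\<close>

lemma eventually_max_schur_free_ge:
  fixes \<epsilon> :: real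
  assumes \<epsilon>: "0 < \<epsilon>" "\<epsilon> \<le> 1"
  shows "\<forall>\<^sub>F p in sequentially. \<epsilon> / 128 \<le> real (max_solution_free schur_eq \<epsilon> p) / real p"
proof -
  \<comment> \<open>The squared bracket has order log^2 p. Its added 1 allows for the ceiling in
    \<open>K\<close>.\<close>
  have "\<forall>\<^sub>F p in sequentially. 3 * (16 * ln (real p) / \<epsilon>\<^sup>2 + 1)\<^sup>2 + 1 \<le> \<epsilon> * real p / 128"
    using \<epsilon>(1) by real_asymp
  then show ?thesis
    using eventually_ge_at_top[of 2]
  proof eventually_elim
    case (elim p)
    define K where "K = nat \<lceil>16 * ln (real p) / \<epsilon>\<^sup>2\<rceil>"
    have pos: "16 * ln (real p) / \<epsilon>\<^sup>2 > 0" using elim \<epsilon> by simp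
    then have K: "16 * ln (real p) / \<epsilon>\<^sup>2 \<le> real K" "real K \<le> 16 * ln (real p) / \<epsilon>\<^sup>2 + 1"
      unfolding K_def by linarith+
    have "(real K)\<^sup>2 \<le> (16 * ln (real p) / \<epsilon>\<^sup>2 + 1)\<^sup>2" using K by (intro power_mono) auto
    then have "3 * (real K)\<^sup>2 + 1 \<le> \<epsilon> * real p / 128" using elim by linarith
    moreover have "K > 0" using pos K by (metis of_nat_0_less_iff order_less_le_trans)
    ultimately obtain A where A: "A \<subseteq> Fp p" "solution_free schur_eq p A"
      "real (independence_number (with_proj (cayley_digraph p A))) \<le> \<epsilon> * real p"
      "\<epsilon> * real p / 128 \<le> real (card A)"
      using ex_dense_schur_free[OF \<epsilon> _ K(1)] by metis
    then have "\<epsilon> * real p / 128 \<le> real (max_solution_free schur_eq \<epsilon> p)"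
      using max_solution_free_ge[OF A(1,2,3)] by linarith
    then show ?case using elim by (simp add: field_simps)
  qed
qed

lemma eventually_max_schur_free_le:
  fixes \<epsilon> :: real
  assumes \<epsilon>: "0 < \<epsilon>"
  shows "\<forall>\<^sub>F p in sequentially.
    odd p \<longrightarrow> real (max_solution_free schur_eq \<epsilon> p) / real p \<le> 4 * \<epsilon>"
proof -
  \<comment> \<open>Once \<epsilon>p is at least 1, the bound 3\<epsilon>p + 1 is at most
    4\<epsilon>p.\<close>
  have "\<forall>\<^sub>F p in sequentially. 1 \<le> \<epsilon> * real p" using \<epsilon> by real_asymp
  then show ?thesis
    using eventually_gt_at_top[of 0]
  proof eventually_elim
    case (elim p)
    have "real (max_solution_free schur_eq \<epsilon> p) \<le> 4 * \<epsilon> * real p" if "odd p"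
    proof (rule max_solution_free_attained[of schur_eq \<epsilon> p])
      fix A assume A: "A \<subseteq> Fp p" "solution_free schur_eq p A"
        "real (independence_number (with_proj (cayley_digraph p A))) \<le> \<epsilon> * real p"
        "card A = max_solution_free schur_eq \<epsilon> p"
      then show ?thesis using card_schur_free_le[OF that A(1,2)] elim by linarith
    qed (use elim in simp)
    then show ?case using elim by (simp add: field_simps)
  qed
qed

text \<open>The infinitude of primes in filter form; it is what places \<open>Liminf\<close> below
  \<open>Limsup\<close>.\<close>

lemma primes_at_top_neq_bot: "inf sequentially (principal {p::nat. prime p}) \<noteq> bot"
proof
  assume "inf sequentially (principal {p::nat. prime p}) = bot"
  then have "\<forall>\<^sub>F p in inf sequentially (principal {p::nat. prime p}). False"
    by (simp only: eventually_bot)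
  then have "\<forall>\<^sub>F p::nat in sequentially. \<not> prime p"
    by (simp add: eventually_inf_principal)
  then obtain N where N: "\<And>p::nat. p \<ge> N \<Longrightarrow> \<not> prime p"
    by (auto simp: eventually_sequentially)
  obtain p where "prime p" "p > N" using bigger_prime by blast
  then show False using N[of p] by simp
qed

theorem theorem1p3:
  shows "\<exists>c C :: real. c > 0 \<and> C > 0 \<and>
    (\<forall>\<epsilon> :: real. 0 < \<epsilon> \<and> \<epsilon> \<le> 1 \<longrightarrow>
       ereal (c * \<epsilon>) \<le> solution_free_density schur_eq \<epsilon> \<and> solution_free_density schur_eq \<epsilon> \<le> ereal (C * \<epsilon>))"
proof (rule exI[of _ "1/128"], rule exI[of _ 4], intro conjI allI impI)
  fix \<epsilon> :: real assume \<epsilon>: "0 < \<epsilon> \<and> \<epsilon> \<le> 1"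
  let ?F = "inf sequentially (principal {p::nat. prime p})"
  let ?g = "\<lambda>p. ereal (real (max_solution_free schur_eq \<epsilon> p) / real p)"
  \<comment> \<open>The lower bound holds for all large primes, so it passes through
    \<open>Liminf\<close>.\<close>
  have "\<forall>\<^sub>F p in ?F. ereal (1 / 128 * \<epsilon>) \<le> ?g p"
    unfolding eventually_inf_principal
    using eventually_max_schur_free_ge[OF conjunct1[OF \<epsilon>] conjunct2[OF \<epsilon>]]
    by eventually_elim simp
  then have "ereal (1 / 128 * \<epsilon>) \<le> Liminf ?F ?g" by (rule Liminf_bounded)
  also have "\<dots> \<le> Limsup ?F ?g" by (rule Liminf_le_Limsup[OF primes_at_top_neq_bot])
  finally show "ereal (1 / 128 * \<epsilon>) \<le> solution_free_density schur_eq \<epsilon>"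
    unfolding solution_free_density_def .
  have "\<forall>\<^sub>F p in ?F. ?g p \<le> ereal (4 * \<epsilon>)"
    unfolding eventually_inf_principal
    using eventually_max_schur_free_le[OF conjunct1[OF \<epsilon>]] eventually_gt_at_top[of 2]
    by eventually_elim (simp add: prime_odd_nat)
  then show "solution_free_density schur_eq \<epsilon> \<le> ereal (4 * \<epsilon>)"
    unfolding solution_free_density_def by (rule Limsup_bounded)
qed simp_all

end
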